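(* Let $\mathbb K$ be a field, and let $f=a_0(x)+a_1(x)y+\cdots+a_n(x)y^n\in \mathbb K[x,y]$ with $a_i\in\mathbb K[x]$ and $a_0a_n\neq 0$. For a real number $\rho>1$, define $H_f=\rho^{\max_{0\leq i\leq n-1}\deg a_i-\deg a_n}$. Suppose there exists a polynomial $a\in \mathbb K[x]$ with $\deg a\geq \frac{\log(H_f+2)}{\log \rho}$, and let $\nu_a$ be the number of irreducible factors of the polynomial $f(x,a(x))$ in $\mathbb K[x]$ counted with multiplicities. Then the polynomial $f(x,y)$ is a product of at most $\nu_a$ irreducible factors in $\mathbb K[x,y]$. In particular, if $\nu_a=1$, then $f$ is irreducible in $\mathbb K[x,y]$.
   Context: Convention: $\deg 0=-\infty$ and $\rho^{-\infty}=0$. *)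

theory Defs
  imports "HOL-Computational_Algebra.Computational_Algebra" "HOL-Library.Extended_Real"
begin

text \<open>
  The ring $K[x,y]$ is represented as $K[x][y]$, i.e. by the type \<open>'a poly poly\<close>: for
  \<open>f = a\<^sub>0(x) + a\<^sub>1(x) y + \<dots> + a\<^sub>n(x) y\<^sup>n\<close> the coefficient \<open>a\<^sub>i\<close> is \<open>coeff f i\<close>,
  and \<open>f(x, a(x))\<close> is \<open>poly f a\<close>.
\<close>

text \<open>Unlike the library's \<^const>\<open>degree\<close>, the zero polynomial has degree \<open>-\<infinity>\<close>.\<close>

definition edeg :: "'a::zero poly \<Rightarrow> ereal" where
  "edeg p = (if p = 0 then -\<infinity> else ereal (real (degree p)))"

text \<open>Exponentiation with \<open>\<rho> ^ (-\<infinity>) = 0\<close>; the exponent \<open>\<infinity>\<close> never arises.\<close>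

definition epowr :: "real \<Rightarrow> ereal \<Rightarrow> real" where
  "epowr \<rho> e = (if e = -\<infinity> then 0 else \<rho> powr real_of_ereal e)"

text \<open>
  The supremum is a maximum over a finite set when \<open>degree f \<ge> 1\<close>; for \<open>degree f = 0\<close> the
  maximum over the empty set is read as \<open>-\<infinity>\<close>.
\<close>

definition H :: "real \<Rightarrow> 'a::zero poly poly \<Rightarrow> real" where
  "H \<rho> f = epowr \<rho> ((SUP i\<in>{..<degree f}. edeg (coeff f i)) - edeg (coeff f (degree f)))"

definition irreducible_factorization :: "'b::comm_semiring_1 \<Rightarrow> 'b multiset \<Rightarrow> bool" where
  "irreducible_factorization p A \<longleftrightarrow>
     (\<forall>q. q \<in># A \<longrightarrow> irreducible q) \<and> (\<exists>u. u dvd 1 \<and> p = u * prod_mset A)"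

text \<open>
  Well defined for nonzero elements of a unique factorization domain. The library's
  \<^const>\<open>prime_factorization\<close> is not available for polynomials over an arbitrary type of
  class \<^class>\<open>field\<close>, as it requires a normalization on the coefficients.
\<close>

definition num_irreducible_factors :: "'b::comm_semiring_1 \<Rightarrow> nat" where
  "num_irreducible_factors p = (THE k. \<exists>A. irreducible_factorization p A \<and> size A = k)"

end

theory Submission
  imports Defs
begin

text \<open>
  Put \<open>d = deg a\<close>. The hypothesis says that \<open>d \<ge> 1\<close> and \<open>deg a\<^sub>i < d + deg a\<^sub>n\<close> for \<open>i < n\<close>.
  Hence, if \<open>y\<close> is given the weight \<open>w = d - 1\<close>, the term of top \<open>y\<close>-degree of \<open>f\<close> attains the maximal
  weighted degree. Weighted degrees are additive, so every factor \<open>g\<close> of \<open>f\<close> inherits this property.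
  With the weight \<open>d\<close> the top term of \<open>g\<close> is then strictly dominant, so there is no cancellation
  in \<open>g(x, a(x))\<close>, which therefore has positive degree unless \<open>g\<close> is a unit. Substituting \<open>a\<close> into
  a factorization of \<open>f\<close> thus gives as many nonunit factors of \<open>f(x, a(x))\<close>.
\<close>

subsection \<open>Counting irreducible factors\<close>

lemma prime_elem_dvd_prod_mset:
  fixes p :: "'b::comm_semiring_1"
  assumes "prime_elem p" "p dvd prod_mset B"
  shows "\<exists>b. b \<in># B \<and> p dvd b"
  using assms(2)
proof (induction B)
  case empty
  with assms(1) show ?case by (simp add: prime_elem_def)
next
  case (add b B)
  then have "p dvd b \<or> p dvd prod_mset B"
    using assms(1) by (simp add: prime_elem_dvd_mult_iff)
  with add.IH show ?case by auto
qed

text \<open>Each prime of \<open>A\<close> divides \<open>c\<close> or some \<open>b\<close> in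
  \<open>B\<close>, so cancelling it costs \<open>B\<close> at most one element. The cofactor left
  over from such a \<open>b\<close> moves into \<open>c\<close>, hence the induction over arbitrary
  \<open>B\<close> and \<open>c\<close>. Once \<open>A\<close> is exhausted, an element of
  \<open>B\<close> would divide the unit \<open>u\<close>.\<close>

lemma size_nonunits_le_size_primes:
  fixes A B :: "'b::idom multiset"
  assumes "\<And>p. p \<in># A \<Longrightarrow> prime_elem p" and "\<And>b. b \<in># B \<Longrightarrow> \<not> b dvd 1"
    and "u dvd 1" and "u * prod_mset A = c * prod_mset B"
  shows "size B \<le> size A"
  using assms
proof (induction A arbitrary: B c)
  case empty
  show ?case
  proof (cases "B = {#}")
    case False
    then obtain b where b: "b \<in># B" by auto
    then have "b dvd c * prod_mset B" by (simp add: dvd_prod_mset)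
    then have "b dvd u" using empty.prems(4) by simp
    then have "b dvd 1" using empty.prems(3) by (rule dvd_trans)
    with empty.prems(2) b show ?thesis by blast
  qed auto
next
  case (add p A)
  have p: "prime_elem p" using add.prems(1) by simp
  then have p0: "p \<noteq> 0" by auto
  have "p dvd u * prod_mset (add_mset p A)" by simp
  then have "p dvd c * prod_mset B" unfolding add.prems(4) .
  then have "p dvd c \<or> p dvd prod_mset B" using p by (simp add: prime_elem_dvd_mult_iff)
  then consider "p dvd c" | b where "b \<in># B" "p dvd b"
    using prime_elem_dvd_prod_mset[OF p] by blast
  then show ?case
  proof cases
    case 1
    then obtain c' where c': "c = p * c'" by (elim dvdE)
    have "p * (u * prod_mset A) = p * (c' * prod_mset B)"
      using add.prems(4) c' by (simp add: mult_ac)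
    then have "u * prod_mset A = c' * prod_mset B" using p0 by simp
    then have "size B \<le> size A"
      using add.IH[of B c'] add.prems(1-3) by auto
    then show ?thesis by simp
  next
    case (2 b)
    then obtain b' where b': "b = p * b'" by (elim dvdE)
    obtain B' where B': "B = add_mset b B'" using 2(1) by (metis multi_member_split)
    have "p * (u * prod_mset A) = p * ((c * b') * prod_mset B')"
      using add.prems(4) b' B' by (simp add: mult_ac)
    then have "u * prod_mset A = (c * b') * prod_mset B'" using p0 by simp
    then have "size B' \<le> size A"
      using add.IH[of B' "c * b'"] add.prems(1-3) B' by auto
    then show ?thesis by (simp add: B')
  qed
qed

text \<open>Splitting a divisor of \<open>p\<close> into two nonunits makes \<open>\<mu>\<close>
  drop strictly on both, so strong induction on \<open>\<mu>\<close> applies. The measure is kept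
  abstract to serve both K[x] and K[x,y].\<close>

lemma irreducible_factorization_exists:
  fixes p :: "'b::idom" and \<mu> :: "'b \<Rightarrow> nat"
  assumes add: "\<And>q r. q * r dvd p \<Longrightarrow> \<mu> (q * r) = \<mu> q + \<mu> r"
    and pos: "\<And>q. q dvd p \<Longrightarrow> \<not> q dvd 1 \<Longrightarrow> \<mu> q > 0"
    and "p \<noteq> 0"
  shows "\<exists>A. irreducible_factorization p A"
proof -
  have "\<exists>A. irreducible_factorization q A" if "q dvd p" for q
    using that
  proof (induction "\<mu> q" arbitrary: q rule: less_induct)
    case less
    have q0: "q \<noteq> 0" using less.prems \<open>p \<noteq> 0\<close> by auto
    consider "q dvd 1" | "irreducible q" | "\<not> q dvd 1" "\<not> irreducible q" by blast
    then show ?case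
    proof cases
      case 1
      then show ?thesis
        by (intro exI[of _ "{#}"]) (auto simp: irreducible_factorization_def)
    next
      case 2
      then show ?thesis
        by (intro exI[of _ "{#q#}"]) (auto simp: irreducible_factorization_def intro!: exI[of _ 1])
    next
      case 3
      then obtain r s where rs: "q = r * s" "\<not> r dvd 1" "\<not> s dvd 1"
        using q0 unfolding irreducible_def by blast
      have dvd: "r dvd p" "s dvd p"
        using less.prems rs(1) by (auto dest: dvd_mult_left dvd_mult_right)
      have "\<mu> q = \<mu> r + \<mu> s" using add less.prems rs(1) by simp
      with pos[OF dvd(1) rs(2)] pos[OF dvd(2) rs(3)] have "\<mu> r < \<mu> q" "\<mu> s < \<mu> q" by auto
      with less.hyps dvd obtain A B
        where "irreducible_factorization r A" "irreducible_factorization s B" by metis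
      then obtain u v where uv: "r = u * prod_mset A" "s = v * prod_mset B" "u dvd 1" "v dvd 1"
        and irr: "\<forall>q. q \<in># A \<longrightarrow> irreducible q" "\<forall>q. q \<in># B \<longrightarrow> irreducible q"
        unfolding irreducible_factorization_def by blast
      have "u * v dvd 1" using uv(3,4) by (metis mult_dvd_mono mult_1)
      moreover have "q = (u * v) * prod_mset (A + B)"
        using rs(1) uv(1,2) by (simp add: mult_ac)
      ultimately have "irreducible_factorization q (A + B)"
        unfolding irreducible_factorization_def using irr by fastforce
      then show ?thesis by blast
    qed
  qed
  then show ?thesis by simp
qed

text \<open>Irreducible elements of K[x] are prime, so two factorizations can be compared in both
  directions; this makes the definite description meaningful.\<close>

lemma num_irreducible_factors_eqI:
  fixes p :: "'a::field poly"
  assumes A: "irreducible_factorization p A"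
  shows "num_irreducible_factors p = size A"
proof -
  have le: "size C \<le> size B"
    if B: "irreducible_factorization p B" and C: "irreducible_factorization p C" for B C
  proof -
    obtain u v where "u dvd 1" "p = u * prod_mset B" "p = v * prod_mset C"
      using B C unfolding irreducible_factorization_def by blast
    moreover have "prime_elem q" if "q \<in># B" for q
      using B that field_poly_irreducible_imp_prime unfolding irreducible_factorization_def by blast
    moreover have "\<not> q dvd 1" if "q \<in># C" for q
      using C that unfolding irreducible_factorization_def by (auto dest: irreducible_not_unit)
    ultimately show ?thesis
      using size_nonunits_le_size_primes[of B C u v] by simp
  qed
  show ?thesis
    unfolding num_irreducible_factors_def
  proof (rule the_equality)
    show "\<exists>B. irreducible_factorization p B \<and> size B = size A" using A by blast
  next
    fix k
    assume "\<exists>B. irreducible_factorization p B \<and> size B = k"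
    then show "k = size A" using le A by (metis le_antisym)
  qed
qed

lemma size_nonunits_le_num_irreducible_factors:
  fixes p c :: "'a::field poly"
  assumes "p \<noteq> 0" "p = c * prod_mset B" "\<And>b. b \<in># B \<Longrightarrow> \<not> b dvd 1"
  shows "size B \<le> num_irreducible_factors p"
proof -
  have "\<exists>A. irreducible_factorization p A"
  proof (rule irreducible_factorization_exists[where \<mu> = degree])
    fix q r assume "q * r dvd p"
    with \<open>p \<noteq> 0\<close> have "q * r \<noteq> 0" by auto
    then show "degree (q * r) = degree q + degree r" by (simp add: degree_mult_eq)
  next
    fix q assume "q dvd p" "\<not> q dvd 1"
    with \<open>p \<noteq> 0\<close> have "q \<noteq> 0" by auto
    with \<open>\<not> q dvd 1\<close> show "degree q > 0" by (simp add: is_unit_iff_degree)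
  qed fact
  then obtain A where A: "irreducible_factorization p A" by blast
  then obtain u where "u dvd 1" "p = u * prod_mset A"
    unfolding irreducible_factorization_def by blast
  moreover have "prime_elem q" if "q \<in># A" for q
    using A that field_poly_irreducible_imp_prime unfolding irreducible_factorization_def by blast
  ultimately have "size B \<le> size A"
    using size_nonunits_le_size_primes[of A B u c] assms by simp
  then show ?thesis using num_irreducible_factors_eqI[OF A] by simp
qed

subsection \<open>Weighted degrees\<close>

text \<open>Taking the largest index of maximal weight gives strictness beyond \<open>I\<close>,
  which later singles out one product term that cannot cancel.\<close>

lemma weighted_degree_attained:
  fixes g :: "'a::zero poly poly" and w :: nat
  assumes "g \<noteq> 0"
  obtains I where "coeff g I \<noteq> 0"
    and "\<And>i. coeff g i \<noteq> 0 \<Longrightarrow> degree (coeff g i) + i * w \<le> degree (coeff g I) + I * w"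
    and "\<And>i. coeff g i \<noteq> 0 \<Longrightarrow> i > I \<Longrightarrow> degree (coeff g i) + i * w < degree (coeff g I) + I * w"
proof -
  define S where "S = {i. coeff g i \<noteq> 0}"
  define wt where "wt i = degree (coeff g i) + i * w" for i
  define M where "M = Max (wt ` S)"
  define T where "T = {i \<in> S. wt i = M}"
  have "S \<subseteq> {..degree g}" unfolding S_def by (auto simp: le_degree)
  then have fin: "finite S" by (rule finite_subset) simp
  have "S \<noteq> {}" using assms unfolding S_def by (metis (mono_tags) empty_iff leading_coeff_0_iff mem_Collect_eq)
  then have "M \<in> wt ` S" unfolding M_def using fin by (intro Max_in) auto
  then have "T \<noteq> {}" unfolding T_def by auto
  moreover have finT: "finite T" using fin unfolding T_def by simp
  ultimately have I: "Max T \<in> T" by (rule Max_in[rotated])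
  have le: "wt i \<le> M" if "i \<in> S" for i unfolding M_def using fin that by simp
  have less: "wt i < M" if "i \<in> S" "i > Max T" for i
  proof -
    have "i \<notin> T" using that(2) Max_ge[OF finT, of i] by linarith
    then show ?thesis using le[OF that(1)] that(1) unfolding T_def by auto
  qed
  show thesis
    using that[of "Max T"] I le less unfolding T_def S_def wt_def by auto
qed

text \<open>With \<open>I\<close> and \<open>J\<close> the last indices of maximal weight in
  \<open>g\<close> and \<open>k\<close>, the monomial of degree \<open>D\<close> in x and
  \<open>I + J\<close> in y survives in \<open>g * k\<close>, so the maximal weights add. The
  weights of the leading terms add too; as the leading term of the product is maximal, neither
  factor has a term heavier than its leading one.\<close>

lemma degree_coeff_factor_le:
  fixes g k :: "'a::idom poly poly" and w :: nat
  assumes nz: "g * k \<noteq> 0"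
    and dom: "\<And>i. coeff (g * k) i \<noteq> 0 \<Longrightarrow>
      degree (coeff (g * k) i) + i * w \<le> degree (lead_coeff (g * k)) + degree (g * k) * w"
    and i: "coeff g i \<noteq> 0"
  shows "degree (coeff g i) + i * w \<le> degree (lead_coeff g) + degree g * w"
proof -
  have g0: "g \<noteq> 0" and k0: "k \<noteq> 0" using nz by auto
  obtain I where I: "coeff g I \<noteq> 0"
    and Ile: "\<And>i. coeff g i \<noteq> 0 \<Longrightarrow> degree (coeff g i) + i * w \<le> degree (coeff g I) + I * w"
    and Iless: "\<And>i. coeff g i \<noteq> 0 \<Longrightarrow> i > I \<Longrightarrow> degree (coeff g i) + i * w < degree (coeff g I) + I * w"
    using weighted_degree_attained[OF g0, of w] by blast
  obtain J where J: "coeff k J \<noteq> 0"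
    and Jle: "\<And>i. coeff k i \<noteq> 0 \<Longrightarrow> degree (coeff k i) + i * w \<le> degree (coeff k J) + J * w"
    and Jless: "\<And>i. coeff k i \<noteq> 0 \<Longrightarrow> i > J \<Longrightarrow> degree (coeff k i) + i * w < degree (coeff k J) + J * w"
    using weighted_degree_attained[OF k0, of w] by blast
  define D where "D = degree (coeff g I) + degree (coeff k J)"
  \<comment> \<open>If \<open>j \<noteq> I\<close>, one of the two indices lies beyond
    \<open>I\<close> or \<open>J\<close>, so the total weight is strictly smaller; the index sum is
    unchanged, so the loss is in the x-degree.\<close>
  have other: "coeff (coeff g j * coeff k (I + J - j)) D = 0" if "j \<le> I + J" "j \<noteq> I" for j
  proof (cases "coeff g j = 0 \<or> coeff k (I + J - j) = 0")
    case False
    define l where "l = I + J - j"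
    have jl: "j + l = I + J" using that(1) by (simp add: l_def)
    then have jw: "j * w + l * w = I * w + J * w" by (metis add_mult_distrib)
    have nz: "coeff g j \<noteq> 0" "coeff k l \<noteq> 0" using False by (auto simp: l_def)
    have "j > I \<or> l > J" using jl that(2) by linarith
    then have "degree (coeff g j) + degree (coeff k l) < D"
      using Ile[OF nz(1)] Jle[OF nz(2)] Iless[OF nz(1)] Jless[OF nz(2)] jw unfolding D_def by linarith
    then have "degree (coeff g j * coeff k l) < D" using nz by (simp add: degree_mult_eq)
    then show ?thesis by (simp add: coeff_eq_0 l_def)
  qed auto
  have "coeff (coeff (g * k) (I + J)) D = (\<Sum>j\<le>I + J. coeff (coeff g j * coeff k (I + J - j)) D)"
    by (simp add: coeff_mult coeff_sum)
  also have "\<dots> = (\<Sum>j\<in>{I}. coeff (coeff g j * coeff k (I + J - j)) D)"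
    by (rule sum.mono_neutral_right) (use other in auto)
  also have "\<dots> = lead_coeff (coeff g I) * lead_coeff (coeff k J)"
    by (simp add: D_def coeff_mult_degree_sum)
  finally have neq: "coeff (coeff (g * k) (I + J)) D \<noteq> 0" using I J by simp
  then have "coeff (g * k) (I + J) \<noteq> 0" by auto
  from dom[OF this] le_degree[OF neq]
  have "D + (I + J) * w \<le> degree (lead_coeff (g * k)) + degree (g * k) * w" by linarith
  also have "\<dots> = (degree (lead_coeff g) + degree g * w) + (degree (lead_coeff k) + degree k * w)"
    unfolding lead_coeff_mult
    using g0 k0 by (simp add: degree_mult_eq add_mult_distrib)
  finally have "degree (coeff g I) + I * w \<le> degree (lead_coeff g) + degree g * w"
    using Jle[of "degree k"] k0 unfolding D_def by (simp add: add_mult_distrib)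
  with Ile[OF i] show ?thesis by linarith
qed

text \<open>Every nonzero lower summand \<open>coeff g i * a ^ i\<close> has smaller degree than the
  top one, so the top one cannot cancel.\<close>

lemma degree_poly_dominant:
  fixes g :: "'a::idom poly poly" and a :: "'a poly"
  assumes g0: "g \<noteq> 0" and a0: "a \<noteq> 0"
    and dom: "\<And>i. i < degree g \<Longrightarrow> coeff g i \<noteq> 0 \<Longrightarrow>
      degree (coeff g i) + i * degree a < degree (lead_coeff g) + degree g * degree a"
  shows "degree (poly g a) = degree (lead_coeff g) + degree g * degree a"
proof -
  define D where "D = degree (lead_coeff g) + degree g * degree a"
  have deg: "degree (coeff g i * a ^ i) = degree (coeff g i) + i * degree a" if "coeff g i \<noteq> 0" for i
    using that a0 by (simp add: degree_mult_eq degree_power_eq)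
  have eq: "poly g a = (\<Sum>i<degree g. coeff g i * a ^ i) + lead_coeff g * a ^ degree g"
    by (simp add: poly_altdef flip: lessThan_Suc_atMost)
  show ?thesis
  proof (cases "degree g = 0")
    case True
    then show ?thesis using eq by simp
  next
    case False
    show ?thesis
    \<comment> \<open>The strict bound on the degree of the sum needs \<open>D > 0\<close>, because
      a zero summand has \<open>degree\<close> 0. For \<open>D = 0\<close> the hypothesis forces all
      lower coefficients to vanish.\<close>
    proof (cases "D = 0")
      case True
      then have "coeff g i = 0" if "i < degree g" for i
        using dom[OF that] unfolding D_def by linarith
      then show ?thesis using eq deg[of "degree g"] g0 by simp
    next
      case D: False
      have "degree (\<Sum>i<degree g. coeff g i * a ^ i) < D"
      proof (rule degree_sum_less)
        fix i assume "i \<in> {..<degree g}"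
        then show "degree (coeff g i * a ^ i) < D"
          using deg[of i] dom[of i] D unfolding D_def by (cases "coeff g i = 0") auto
      qed (use D in simp)
      then show ?thesis
        using eq deg[of "degree g"] g0 unfolding D_def by (simp add: degree_add_eq_right)
    qed
  qed
qed

lemma degree_poly_factor_pos:
  fixes f g :: "'a::field poly poly" and a :: "'a poly"
  assumes "f \<noteq> 0" "degree a > 0" "g dvd f" "\<not> g dvd 1"
    and dom: "\<And>i. i < degree f \<Longrightarrow> coeff f i \<noteq> 0 \<Longrightarrow>
      degree (coeff f i) < degree (lead_coeff f) + degree a"
  shows "degree (poly g a) > 0"
proof -
  \<comment> \<open>The strict bound \<open>dom\<close> gives at most
    \<open>degree (lead_coeff f) + w\<close>, and \<open>i + 1 \<le> degree f\<close>; so the top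
    term is maximal for the weight \<open>w\<close>, a nonstrict property that passes to
    factors.\<close>
  define w where "w = degree a - 1"
  have w: "degree a = Suc w" using assms(2) by (simp add: w_def)
  obtain k where k: "f = g * k" using assms(3) by (elim dvdE)
  have g0: "g \<noteq> 0" using assms(1) k by auto
  have domf: "degree (coeff f i) + i * w \<le> degree (lead_coeff f) + degree f * w"
    if "coeff f i \<noteq> 0" for i
  proof (cases "i < degree f")
    case True
    have "degree (coeff f i) + i * w \<le> degree (lead_coeff f) + (Suc i) * w"
      using dom[OF True that] w by simp
    also have "\<dots> \<le> degree (lead_coeff f) + degree f * w"
      using True by (intro add_left_mono mult_right_mono) auto
    finally show ?thesis .
  next
    case False
    then have "i = degree f" using le_degree[OF that] by simp
    then show ?thesis by simp
  qed
  have domg: "degree (coeff g i) + i * w \<le> degree (lead_coeff g) + degree g * w"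
    if "coeff g i \<noteq> 0" for i
    by (rule degree_coeff_factor_le[of g k]) (use assms(1) k domf that in auto)
  have "degree (poly g a) = degree (lead_coeff g) + degree g * degree a"
  proof (rule degree_poly_dominant)
    \<comment> \<open>Going from \<open>w\<close> back to \<open>w + 1\<close> adds \<open>i\<close>
      on the left and the larger \<open>degree g\<close> on the right, so the bound becomes
      strict.\<close>
    fix i assume "i < degree g" "coeff g i \<noteq> 0"
    then show "degree (coeff g i) + i * degree a < degree (lead_coeff g) + degree g * degree a"
      using domg[of i] w by simp
  qed (use g0 assms(2) in auto)
  moreover have "degree (lead_coeff g) + degree g * degree a > 0"
  proof (cases "degree g = 0")
    \<comment> \<open>A factor free of y is a nonzero nonunit of K[x], so it already has positive
      degree in x.\<close>
    case True
    then obtain b where b: "g = [:b:]" by (metis degree_eq_zeroE)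
    then have "\<not> b dvd 1" using assms(4) by (simp add: is_unit_const_poly_iff)
    moreover have "b \<noteq> 0" using b g0 by simp
    ultimately show ?thesis using b by (simp add: is_unit_iff_degree)
  qed (use assms(2) in simp)
  ultimately show ?thesis by simp
qed

subsection \<open>The hypothesis on the degree of \<open>a\<close>\<close>

lemma H_nonneg: "H \<rho> f \<ge> 0"
  by (simp add: H_def epowr_def)

lemma powr_le_H:
  fixes f :: "'a::zero poly poly"
  assumes "\<rho> > 1" "i < degree f" "coeff f i \<noteq> 0"
  shows "\<rho> powr (real (degree (coeff f i)) - real (degree (lead_coeff f))) \<le> H \<rho> f"
proof -
  define S where "S = (SUP i\<in>{..<degree f}. edeg (coeff f i))"
  have "f \<noteq> 0" using assms(3) by auto
  have "edeg (coeff f i) \<le> S" unfolding S_def by (rule SUP_upper) (use assms in simp)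
  then have lower: "ereal (real (degree (coeff f i))) \<le> S" using assms(3) by (simp add: edeg_def)
  \<comment> \<open>Any real upper bound will do: together with \<open>lower\<close> it makes
    \<open>S\<close> finite, so that \<open>epowr\<close> reduces to \<open>powr\<close>.\<close>
  have "S \<le> ereal (real (\<Sum>j<degree f. degree (coeff f j)))"
    unfolding S_def
  proof (rule SUP_least)
    fix j assume "j \<in> {..<degree f}"
    then have "degree (coeff f j) \<le> (\<Sum>j<degree f. degree (coeff f j))"
      by (intro member_le_sum) auto
    then show "edeg (coeff f j) \<le> ereal (real (\<Sum>j<degree f. degree (coeff f j)))"
      by (simp add: edeg_def del: of_nat_sum)
  qed
  with lower obtain s where s: "S = ereal s" by (cases S) auto
  then have "H \<rho> f = \<rho> powr (s - real (degree (lead_coeff f)))"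
    unfolding H_def S_def[symmetric] using \<open>f \<noteq> 0\<close> by (simp add: edeg_def epowr_def)
  then show ?thesis using lower s assms(1) by simp
qed

lemma degree_bounds_of_H:
  fixes f :: "'a::zero poly poly" and a :: "'a poly"
  assumes \<rho>: "\<rho> > 1" and a: "edeg a \<ge> ereal (ln (H \<rho> f + 2) / ln \<rho>)"
  shows "degree a > 0"
    and "\<And>i. i < degree f \<Longrightarrow> coeff f i \<noteq> 0 \<Longrightarrow>
      degree (coeff f i) < degree (lead_coeff f) + degree a"
proof -
  have pos: "H \<rho> f + 2 > 0" using H_nonneg[of \<rho> f] by simp
  \<comment> \<open>The case \<open>a = 0\<close> is excluded, since then \<open>edeg a\<close> is
    minus infinity.\<close>
  have "ln (H \<rho> f + 2) / ln \<rho> \<le> real (degree a)"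
    using a by (auto simp: edeg_def split: if_splits)
  then have "log \<rho> (H \<rho> f + 2) \<le> real (degree a)" by (simp add: log_def)
  then have le: "H \<rho> f + 2 \<le> \<rho> powr real (degree a)"
    using \<rho> pos by (simp add: log_le_iff)
  \<comment> \<open>A constant \<open>a\<close> would give
    \<open>H \<rho> f + 2 \<le> 1\<close>.\<close>
  show "degree a > 0"
    using le H_nonneg[of \<rho> f] \<rho> by (cases "degree a = 0") auto
  fix i assume "i < degree f" "coeff f i \<noteq> 0"
  from powr_le_H[OF \<rho> this] le
  have "\<rho> powr (real (degree (coeff f i)) - real (degree (lead_coeff f))) < \<rho> powr real (degree a)"
    by linarith
  then have "real (degree (coeff f i)) - real (degree (lead_coeff f)) < real (degree a)"
    using \<rho> by simp
  then show "degree (coeff f i) < degree (lead_coeff f) + degree a" by linarith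
qed

section \<open>Substituting \<open>a\<close> for y in a factorization of \<open>f\<close>\<close>

theorem theorem4:
  fixes f :: "'a::field poly poly" and n :: nat and \<rho> :: real and a :: "'a poly"
  assumes "degree f = n"
    and "coeff f 0 * coeff f n \<noteq> 0"
    and "\<rho> > 1"
    and "edeg a \<ge> ereal (ln (H \<rho> f + 2) / ln \<rho>)"
  shows "(\<exists>A. irreducible_factorization f A \<and>
               size A \<le> num_irreducible_factors (poly f a)) \<and>
         (num_irreducible_factors (poly f a) = 1 \<longrightarrow> irreducible f)"
proof -
  have f0: "f \<noteq> 0" using assms(2) by auto
  note bounds = degree_bounds_of_H[OF assms(3,4)]
  have pos: "degree (poly g a) > 0" if "g dvd f" "\<not> g dvd 1" for g
    by (rule degree_poly_factor_pos[OF f0 bounds(1) that bounds(2)])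
  have unit: "poly g a dvd 1" if "g dvd 1" for g
    using that by (metis dvdE dvdI poly_1 poly_mult)
  have nz: "poly g a \<noteq> 0" if "g dvd f" for g
    using pos[OF that] unit[of g] by (cases "g dvd 1") auto
  \<comment> \<open>The degree after substitution is positive on nonunit divisors of
    \<open>f\<close>, and additive because \<open>nz\<close> keeps the substituted divisors
    nonzero.\<close>
  have "\<exists>A. irreducible_factorization f A"
  proof (rule irreducible_factorization_exists[where \<mu> = "\<lambda>g. degree (poly g a)"])
    fix q r assume "q * r dvd f"
    from nz[OF this] show "degree (poly (q * r) a) = degree (poly q a) + degree (poly r a)"
      by (simp add: degree_mult_eq)
  qed (use pos f0 in auto)
  then obtain A where A: "irreducible_factorization f A" by blast
  then obtain u where u: "u dvd 1" "f = u * prod_mset A"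
    and irr: "\<And>q. q \<in># A \<Longrightarrow> irreducible q"
    unfolding irreducible_factorization_def by blast
  define B where "B = image_mset (\<lambda>g. poly g a) A"
  have "poly (prod_mset A) a = prod_mset B"
    unfolding B_def by (induction A) auto
  then have fa: "poly f a = poly u a * prod_mset B" using u(2) by simp
  have "\<not> b dvd 1" if "b \<in># B" for b
  proof -
    have "b \<in> (\<lambda>g. poly g a) ` set_mset A" using that unfolding B_def by simp
    then obtain g where g: "g \<in># A" "b = poly g a" by blast
    have "g dvd f" using u(2) g(1) by (simp add: dvd_prod_mset)
    moreover have "\<not> g dvd 1" using irr[OF g(1)] by (rule irreducible_not_unit)
    ultimately have "degree b > 0" using pos g(2) by simp
    then show ?thesis using is_unit_iff_degree[of b] by fastforce
  qed
  then have le: "size A \<le> num_irreducible_factors (poly f a)"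
    using size_nonunits_le_num_irreducible_factors[OF nz fa] by (simp add: B_def)
  moreover have "irreducible f" if one: "num_irreducible_factors (poly f a) = 1"
  proof (cases "A = {#}")
    case True
    then have "irreducible_factorization (poly f a) {#}"
      using u unit unfolding irreducible_factorization_def by simp
    from num_irreducible_factors_eqI[OF this] one show ?thesis by simp
  next
    case False
    then have "size A = 1" using le one by (simp add: le_Suc_eq)
    then obtain q where "A = {#q#}" by (metis One_nat_def size_1_singleton_mset)
    then show ?thesis using irr[of q] u by (simp add: irreducible_mult_unit_left)
  qed
  ultimately show ?thesis using A by blast
qed

end
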